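(* Every $f\in\mathcal{F}_H^0$ satisfies $$|z|-\tfrac12|z|^2\le |f(z)|\le |z|+\tfrac12|z|^2,\qquad z\in\mathbb{D}.$$ In particular, the range $f(\mathbb{D})$ of each $f\in\mathcal{F}_H^0$ contains the disk $\{w\in\mathbb{C}:|w|<1/2\}$. Moreover, these results are sharp for each of the functions $f(z)=z+z^2/2$ and $f(z)=z+\overline{z}^{\,2}/2$: for each of these two functions (which lie in $\mathcal{F}_H^0$) and every $r\in(0,1)$, equality in the lower bound and equality in the upper bound are attained at points of $|z|=r$, and its range contains no disk $\{|w|<\rho\}$ with $\rho>1/2$.
   Context: $\mathbb{D}=\{z\in\mathbb{C}:|z|<1\}$. $\mathcal{F}_H^0$ is the class of all complex-valued harmonic functions $f$ in $\mathbb{D}$ with $f(0)=0$, $f_z(0)=1$, $f_{\bar z}(0)=0$ and $|f_z(z)-1|<1-|f_{\bar z}(z)|$ for all $z\in\mathbb{D}$. *)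

theory Defs
  imports "HOL-Analysis.Analysis"
begin

text \<open>
  Partial derivatives with respect to the real coordinates of \<open>z = x + i y\<close>. The derivative below
  is the Frechet derivative over the reals, so for differentiable \<open>f\<close> these are the derivatives
  of \<open>f\<close> in the directions \<open>1\<close> and \<open>\<i>\<close>; they are only meaningful where \<open>f\<close> is differentiable.
\<close>

definition dx :: "(complex \<Rightarrow> complex) \<Rightarrow> complex \<Rightarrow> complex" where
  "dx f z = frechet_derivative f (at z) 1"

definition dy :: "(complex \<Rightarrow> complex) \<Rightarrow> complex \<Rightarrow> complex" where
  "dy f z = frechet_derivative f (at z) \<i>"

definition C1_on :: "complex set \<Rightarrow> (complex \<Rightarrow> complex) \<Rightarrow> bool" where
  "C1_on S f \<longleftrightarrow> (\<forall>z\<in>S. f differentiable (at z)) \<and>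
     continuous_on S (dx f) \<and> continuous_on S (dy f)"

definition C2_on :: "complex set \<Rightarrow> (complex \<Rightarrow> complex) \<Rightarrow> bool" where
  "C2_on S f \<longleftrightarrow> C1_on S f \<and> C1_on S (dx f) \<and> C1_on S (dy f)"

definition harmonic_on :: "complex set \<Rightarrow> (complex \<Rightarrow> complex) \<Rightarrow> bool" where
  "harmonic_on S f \<longleftrightarrow> open S \<and> C2_on S f \<and> (\<forall>z\<in>S. dx (dx f) z + dy (dy f) z = 0)"

text \<open>The Wirtinger derivatives \<open>f\<^sub>z\<close> and \<open>f\<close> with subscript \<open>z\<close>-bar.\<close>

definition dz :: "(complex \<Rightarrow> complex) \<Rightarrow> complex \<Rightarrow> complex" where
  "dz f z = (dx f z - \<i> * dy f z) / 2"

definition dzbar :: "(complex \<Rightarrow> complex) \<Rightarrow> complex \<Rightarrow> complex" where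
  "dzbar f z = (dx f z + \<i> * dy f z) / 2"

abbreviation unit_disk :: "complex set"  (\<open>\<DD>\<close>) where
  "\<DD> \<equiv> ball 0 1"

text \<open>
  Functions on the disk are represented by total functions on the complex plane; membership does
  not depend on the values outside the (open) disk.
\<close>

definition FH0 :: "(complex \<Rightarrow> complex) set" where
  "FH0 = {f. harmonic_on \<DD> f \<and> f 0 = 0 \<and> dz f 0 = 1 \<and> dzbar f 0 = 0 \<and>
             (\<forall>z\<in>\<DD>. cmod (dz f z - 1) < 1 - cmod (dzbar f z))}"

end

theory Submission
  imports Defs "HOL-Complex_Analysis.Conformal_Mappings"
begin

text \<open>
  A harmonic \<open>f\<close> splits its differential as \<open>df = f\<^sub>z dz + f\<^bsub>z-bar\<^esub> dz-bar\<close>, where \<open>f\<^sub>z\<close> and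
  the conjugate of \<open>f\<^bsub>z-bar\<^esub>\<close> are holomorphic: their Cauchy--Riemann equations are the Laplace
  equation together with the symmetry of the mixed second partials
  (\<open>harmonic_Wirtinger_holomorphic\<close>). For every unimodular \<open>\<epsilon>\<close> the defining inequality of the
  class makes \<open>F = f\<^sub>z - 1 + \<epsilon> * cnj f\<^bsub>z-bar\<^esub>\<close> a holomorphic map of the disk into itself with
  \<open>F 0 = 0\<close>. The Schwarz lemma gives \<open>\<bar>F z\<bar> \<le> \<bar>z\<bar>\<close>, and choosing \<open>\<epsilon>\<close> to align the two summands
  at \<open>z\<close> turns this into \<open>\<bar>f\<^sub>z z - 1\<bar> + \<bar>f\<^bsub>z-bar\<^esub> z\<bar> \<le> \<bar>z\<bar>\<close> (\<open>FH0_Wirtinger_bound\<close>).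

  Integrating along the radius from \<open>0\<close> to \<open>z\<close> yields \<open>\<bar>f z - z\<bar> \<le> \<bar>z\<bar>\<^sup>2 / 2\<close>
  (\<open>FH0_distance_to_id\<close>), from which both growth estimates are the triangle inequality. The same
  estimate settles the covering statement: for \<open>\<bar>w\<bar> < 1/2\<close> the map \<open>z \<mapsto> w - (f z - z)\<close> sends the
  closed disk of radius \<open>2 * \<bar>w\<bar>\<close> into itself, so it has a fixed point by Brouwer's theorem,
  and a fixed point is a solution of \<open>f z = w\<close>. For the two extremal functions both equalities
  occur on the real axis, and the value \<open>-1/2\<close> is attained in the closed disk only at \<open>z = -1\<close>.
\<close>

section \<open>Symmetry of second derivatives\<close>

text \<open>
  The second difference of \<open>f\<close> over a small parallelogram is to leading order the second derivative,
  differentiating first along \<open>u\<close> and then along \<open>v\<close>. The left-hand side of the estimate is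
  symmetric in \<open>u\<close> and \<open>v\<close> apart from the term \<open>P v\<close>, which is what forces symmetry.
\<close>

lemma second_difference_estimate:
  fixes f :: "'a::real_normed_vector \<Rightarrow> 'b::real_normed_vector"
  assumes "open S" "z \<in> S"
    and der: "\<And>x. x \<in> S \<Longrightarrow> (f has_derivative f' x) (at x)"
    and derP: "((\<lambda>x. f' x u) has_derivative P) (at z)"
    and "0 < e"
  shows "\<exists>d>0. \<forall>h::real. 0 < h \<and> h < d \<longrightarrow>
    norm (f (z + h *\<^sub>R u + h *\<^sub>R v) - f (z + h *\<^sub>R u) - f (z + h *\<^sub>R v) + f z - h\<^sup>2 *\<^sub>R P v) \<le> e * h\<^sup>2"
proof -
  define K where "K = norm u + norm v + 1"
  have K: "K > 0" unfolding K_def by (smt (verit) norm_ge_zero)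
  obtain r where r: "r > 0" "ball z r \<subseteq> S"
    using assms(1,2) openE by blast
  have "e / (2 * K) > 0" using K \<open>0 < e\<close> by simp
  then obtain d1 where d1: "d1 > 0"
    and d1b: "\<And>y. norm (y - z) < d1 \<Longrightarrow>
      norm (f' y u - f' z u - P (y - z)) \<le> e / (2 * K) * norm (y - z)"
    using derP unfolding has_derivative_at_alt by meson
  interpret P: bounded_linear P using derP by (rule has_derivative_bounded_linear)
  define d where "d = min r d1 / K"
  have "d > 0" using r d1 K by (simp add: d_def)
  moreover have "norm (f (z + h *\<^sub>R u + h *\<^sub>R v) - f (z + h *\<^sub>R u) - f (z + h *\<^sub>R v) + f z - h\<^sup>2 *\<^sub>R P v)
      \<le> e * h\<^sup>2" if h: "0 < h" "h < d" for h :: real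
  proof -
    have hK: "h * K < r" "h * K < d1"
      using h K unfolding d_def by (simp_all add: pos_less_divide_eq)
    have near: "norm ((t * h) *\<^sub>R u + (s * h) *\<^sub>R v) \<le> h * K"
      if "0 \<le> t" "t \<le> 1" "0 \<le> s" "s \<le> 1" for s t :: real
    proof -
      have "norm ((t * h) *\<^sub>R u + (s * h) *\<^sub>R v) \<le> (t * h) * norm u + (s * h) * norm v"
        using norm_triangle_ineq[of "(t * h) *\<^sub>R u" "(s * h) *\<^sub>R v"] that h by simp
      also have "\<dots> \<le> h * norm u + h * norm v"
        using that h by (intro add_mono mult_right_mono) auto
      also have "\<dots> \<le> h * K" using h by (simp add: K_def algebra_simps)
      finally show ?thesis .
    qed
    define pt where "pt = (\<lambda>s t. z + (t * h) *\<^sub>R u + (s * h) *\<^sub>R v)"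
    have pt_near: "norm (pt s t - z) \<le> h * K"
      if "0 \<le> t" "t \<le> 1" "0 \<le> s" "s \<le> 1" for s t
      using near[OF that] by (simp add: pt_def add.assoc)
    have ptS: "pt s t \<in> S" if "0 \<le> t" "t \<le> 1" "0 \<le> s" "s \<le> 1" for s t
      using pt_near[OF that] hK(1) r(2) by (auto simp: dist_norm norm_minus_commute)
    have pt_der: "((\<lambda>t. f (pt s t)) has_vector_derivative h *\<^sub>R f' (pt s t) u) (at t)"
      if "0 \<le> t" "t \<le> 1" "0 \<le> s" "s \<le> 1" for s t
    proof -
      have 1: "(pt s has_derivative (\<lambda>x. (x * h) *\<^sub>R u)) (at t)"
        unfolding pt_def by (auto intro!: derivative_eq_intros)
      have "((f \<circ> pt s) has_derivative (f' (pt s t) \<circ> (\<lambda>x. (x * h) *\<^sub>R u))) (at t)"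
        by (rule diff_chain_at[OF 1 der[OF ptS[OF that]]])
      moreover have "linear (f' (pt s t))"
        using der[OF ptS[OF that]] has_derivative_linear by blast
      ultimately show ?thesis
        by (simp add: has_vector_derivative_def o_def linear_cmul)
    qed
    define g where "g = (\<lambda>t. f (pt 1 t) - f (pt 0 t) - (t * h\<^sup>2) *\<^sub>R P v)"
    define g' where "g' = (\<lambda>t. h *\<^sub>R f' (pt 1 t) u - h *\<^sub>R f' (pt 0 t) u - h\<^sup>2 *\<^sub>R P v)"
    have g_der: "(g has_vector_derivative g' t) (at t)" if "0 \<le> t" "t \<le> 1" for t
      unfolding g_def g'_def
      using that by (auto intro!: derivative_eq_intros pt_der)
    have g'_bound: "norm (g' t) \<le> e * h\<^sup>2" if t: "0 < t" "t < 1" for t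
    proof -
      define R where "R = (\<lambda>y. f' y u - f' z u - P (y - z))"
      have R: "norm (R (pt s t)) \<le> e / 2 * h" if "0 \<le> s" "s \<le> 1" for s
      proof -
        have "norm (R (pt s t)) \<le> e / (2 * K) * norm (pt s t - z)"
          unfolding R_def using pt_near[of t s] that t hK by (intro d1b) auto
        also have "\<dots> \<le> e / (2 * K) * (h * K)"
          using pt_near[of t s] that t \<open>e / (2 * K) > 0\<close> by (intro mult_left_mono) auto
        also have "\<dots> = e / 2 * h" using K by simp
        finally show ?thesis .
      qed
      have "P (pt 1 t - z) - P (pt 0 t - z) = h *\<^sub>R P v"
        by (simp add: pt_def P.add P.scaleR P.diff)
      then have "g' t = h *\<^sub>R (R (pt 1 t) - R (pt 0 t))"
        by (simp add: g'_def R_def algebra_simps power2_eq_square flip: scaleR_scaleR)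
      then have "norm (g' t) = h * norm (R (pt 1 t) - R (pt 0 t))" using h by simp
      also have "\<dots> \<le> h * (e / 2 * h + e / 2 * h)"
        using h R[of 1] R[of 0] by (intro mult_left_mono order_trans[OF norm_triangle_ineq4]) auto
      also have "\<dots> = e * h\<^sup>2" by (simp add: power2_eq_square)
      finally show ?thesis .
    qed
    have "norm (g 1 - g 0) \<le> 1 * (e * h\<^sup>2) - 0 * (e * h\<^sup>2)"
    proof (rule differentiable_bound_general[of 0 1 g "\<lambda>t. t * (e * h\<^sup>2)" g' "\<lambda>_. e * h\<^sup>2"])
      show "continuous_on {0..1} g"
        using g_der by (intro continuous_at_imp_continuous_on ballI)
          (auto intro: has_vector_derivative_continuous)
    qed (auto intro!: g_der g'_bound derivative_eq_intros continuous_intros)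
    then show ?thesis by (simp add: g_def pt_def algebra_simps)
  qed
  ultimately show ?thesis by blast
qed

lemma second_derivative_symmetric:
  fixes f :: "'a::real_normed_vector \<Rightarrow> 'b::real_normed_vector"
  assumes "open S" "z \<in> S"
    and der: "\<And>x. x \<in> S \<Longrightarrow> (f has_derivative f' x) (at x)"
    and derP: "((\<lambda>x. f' x u) has_derivative P) (at z)"
    and derQ: "((\<lambda>x. f' x v) has_derivative Q) (at z)"
  shows "P v = Q u"
proof (rule ccontr)
  assume "P v \<noteq> Q u"
  define e where "e = norm (P v - Q u) / 3"
  have e: "e > 0" using \<open>P v \<noteq> Q u\<close> by (simp add: e_def)
  define D where "D = (\<lambda>h. f (z + h *\<^sub>R u + h *\<^sub>R v) - f (z + h *\<^sub>R u) - f (z + h *\<^sub>R v) + f z)"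
  obtain d1 where "d1 > 0"
    and d1: "\<And>h. 0 < h \<Longrightarrow> h < d1 \<Longrightarrow> norm (D h - h\<^sup>2 *\<^sub>R P v) \<le> e * h\<^sup>2"
    using second_difference_estimate[OF assms(1,2) der derP e, of v] unfolding D_def by blast
  have D_swap: "f (z + h *\<^sub>R v + h *\<^sub>R u) - f (z + h *\<^sub>R v) - f (z + h *\<^sub>R u) + f z = D h" for h
    by (simp add: D_def algebra_simps)
  obtain d2 where "d2 > 0"
    and d2: "\<And>h. 0 < h \<Longrightarrow> h < d2 \<Longrightarrow> norm (D h - h\<^sup>2 *\<^sub>R Q u) \<le> e * h\<^sup>2"
    using second_difference_estimate[OF assms(1,2) der derQ e, of u] unfolding D_swap by blast
  define h where "h = min d1 d2 / 2"
  have h: "0 < h" "h < d1" "h < d2" using \<open>d1 > 0\<close> \<open>d2 > 0\<close> by (auto simp: h_def)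
  have "h\<^sup>2 * norm (P v - Q u) = norm ((D h - h\<^sup>2 *\<^sub>R Q u) - (D h - h\<^sup>2 *\<^sub>R P v))"
    by (simp flip: scaleR_diff_right)
  also have "\<dots> \<le> e * h\<^sup>2 + e * h\<^sup>2"
    using d1[OF h(1,2)] d2[OF h(1,3)] by (intro order_trans[OF norm_triangle_ineq4]) auto
  also have "\<dots> < h\<^sup>2 * (3 * e)" using h(1) e by simp
  also have "\<dots> = h\<^sup>2 * norm (P v - Q u)" by (simp add: e_def)
  finally show False by simp
qed

section \<open>Wirtinger derivatives of harmonic functions\<close>

lemma has_derivative_dx_dy:
  assumes "f differentiable (at z)"
  shows "(f has_derivative (\<lambda>v. Re v *\<^sub>R dx f z + Im v *\<^sub>R dy f z)) (at z)"
proof -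
  let ?L = "frechet_derivative f (at z)"
  have L: "(f has_derivative ?L) (at z)"
    using assms by (simp add: frechet_derivative_works)
  have "?L v = Re v *\<^sub>R dx f z + Im v *\<^sub>R dy f z" for v
  proof -
    have "v = Re v *\<^sub>R 1 + Im v *\<^sub>R \<i>"
      by (simp add: complex_eq_iff)
    then have "?L v = ?L (Re v *\<^sub>R 1 + Im v *\<^sub>R \<i>)" by (rule arg_cong)
    also have "\<dots> = Re v *\<^sub>R dx f z + Im v *\<^sub>R dy f z"
      using has_derivative_linear[OF L] unfolding dx_def dy_def
      by (simp only: linear_add linear_cmul)
    finally show ?thesis .
  qed
  then have "?L = (\<lambda>v. Re v *\<^sub>R dx f z + Im v *\<^sub>R dy f z)" by blast
  with L show ?thesis by simp
qed

lemma has_derivative_Wirtinger: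
  assumes "f differentiable (at z)"
  shows "(f has_derivative (\<lambda>v. dz f z * v + dzbar f z * cnj v)) (at z)"
proof -
  have "Re v *\<^sub>R dx f z + Im v *\<^sub>R dy f z = dz f z * v + dzbar f z * cnj v" for v
    by (simp add: dz_def dzbar_def complex_eq_iff field_simps)
  with has_derivative_dx_dy[OF assms] show ?thesis by simp
qed

lemma harmonic_on_has_derivative:
  assumes "harmonic_on S f" "z \<in> S"
  shows "(f has_derivative (\<lambda>v. dz f z * v + dzbar f z * cnj v)) (at z)"
  using assms has_derivative_Wirtinger
  by (auto simp: harmonic_on_def C2_on_def C1_on_def)

lemma dx_dy_commute:
  assumes "open S" "C2_on S f" "z \<in> S"
  shows "dy (dx f) z = dx (dy f) z"
proof -
  have der: "(f has_derivative frechet_derivative f (at x)) (at x)" if "x \<in> S" for x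
    using assms that by (auto simp: C2_on_def C1_on_def frechet_derivative_works)
  have "(dx f has_derivative frechet_derivative (dx f) (at z)) (at z)"
    and "(dy f has_derivative frechet_derivative (dy f) (at z)) (at z)"
    using assms by (auto simp: C2_on_def C1_on_def frechet_derivative_works)
  then have "frechet_derivative (dx f) (at z) \<i> = frechet_derivative (dy f) (at z) 1"
    using second_derivative_symmetric[OF assms(1,3) der] unfolding dx_def dy_def by blast
  then show ?thesis by (simp add: dx_def dy_def)
qed

text \<open>
  With \<open>p = dx f\<close> and \<open>q = dy f\<close>, the Laplace equation reads \<open>p\<^sub>x = - q\<^sub>y\<close> and symmetry reads
  \<open>p\<^sub>y = q\<^sub>x\<close>; these are the two relations that make the derivatives of \<open>(p - \<i> * q) / 2\<close> and of
  \<open>cnj ((p + \<i> * q) / 2)\<close> complex linear.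
\<close>

lemma harmonic_Wirtinger_holomorphic:
  assumes "harmonic_on S f"
  shows "dz f holomorphic_on S" and "(\<lambda>z. cnj (dzbar f z)) holomorphic_on S"
proof -
  have S: "open S" "C2_on S f" using assms by (auto simp: harmonic_on_def)
  have "(dz f has_field_derivative (dx (dx f) z - \<i> * dx (dy f) z) / 2) (at z)
    \<and> ((\<lambda>z. cnj (dzbar f z)) has_field_derivative cnj ((dx (dx f) z + \<i> * dx (dy f) z) / 2)) (at z)"
    if z: "z \<in> S" for z
  proof -
    let ?P1 = "dx (dx f) z" and ?Q1 = "dx (dy f) z"
    have sym: "dy (dx f) z = ?Q1" using dx_dy_commute[OF S z] .
    have lap: "dy (dy f) z = - ?P1"
      using assms z by (auto simp: harmonic_on_def add_eq_0_iff2 minus_equation_iff)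
    have p: "(dx f has_derivative (\<lambda>v. Re v *\<^sub>R ?P1 + Im v *\<^sub>R ?Q1)) (at z)"
      using has_derivative_dx_dy[of "dx f" z] S z by (simp add: C2_on_def C1_on_def sym)
    have q: "(dy f has_derivative (\<lambda>v. Re v *\<^sub>R ?Q1 - Im v *\<^sub>R ?P1)) (at z)"
      using has_derivative_dx_dy[of "dy f" z] S z by (simp add: C2_on_def C1_on_def lap)
    have "(dz f has_derivative (\<lambda>v. ((Re v *\<^sub>R ?P1 + Im v *\<^sub>R ?Q1)
        - \<i> * (Re v *\<^sub>R ?Q1 - Im v *\<^sub>R ?P1)) / 2)) (at z)"
      unfolding dz_def[abs_def]
      by (auto intro!: derivative_eq_intros p q simp: fun_eq_iff complex_eq_iff field_simps)
    moreover have "((\<lambda>z. cnj (dzbar f z)) has_derivative (\<lambda>v. cnj (((Re v *\<^sub>R ?P1 + Im v *\<^sub>R ?Q1)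
        + \<i> * (Re v *\<^sub>R ?Q1 - Im v *\<^sub>R ?P1)) / 2))) (at z)"
      unfolding dzbar_def[abs_def]
      by (intro has_derivative_cnj)
        (auto intro!: derivative_eq_intros p q simp: fun_eq_iff complex_eq_iff field_simps)
    ultimately show ?thesis
      unfolding has_field_derivative_def
      by (auto elim!: has_derivative_eq_rhs simp: fun_eq_iff complex_eq_iff field_simps)
  qed
  then show "dz f holomorphic_on S" and "(\<lambda>z. cnj (dzbar f z)) holomorphic_on S"
    using S(1) by (auto simp: holomorphic_on_open)
qed

section \<open>Growth and covering\<close>

lemma exists_aligning_rotation:
  fixes a b :: complex
  shows "\<exists>\<epsilon>. cmod \<epsilon> = 1 \<and> cmod (a + \<epsilon> * b) = cmod a + cmod b"
proof (cases "a = 0 \<or> b = 0")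
  case True
  then show ?thesis by (intro exI[of _ 1]) auto
next
  case False
  define \<epsilon> where "\<epsilon> = sgn a * cnj (sgn b)"
  have "cnj (sgn b) * b = of_real (cmod b)"
    using False
    by (simp add: sgn_eq complex_norm_square[symmetric] mult.commute[of "cnj b"] power2_eq_square)
  moreover have "sgn a * of_real (cmod a) = a"
    using False by (simp add: sgn_eq)
  ultimately have "a + \<epsilon> * b = sgn a * of_real (cmod a + cmod b)"
    by (simp add: \<epsilon>_def mult.assoc distrib_left)
  then have "cmod (a + \<epsilon> * b) = cmod a + cmod b"
    using False by (simp add: norm_mult norm_sgn del: of_real_add)
  moreover have "cmod \<epsilon> = 1" using False by (simp add: \<epsilon>_def norm_mult norm_sgn)
  ultimately show ?thesis by blast
qed

lemma FH0_Wirtinger_bound: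
  assumes f: "f \<in> FH0" and z: "z \<in> \<DD>"
  shows "cmod (dz f z - 1) + cmod (dzbar f z) \<le> cmod z"
proof -
  have hol: "dz f holomorphic_on \<DD>" "(\<lambda>z. cnj (dzbar f z)) holomorphic_on \<DD>"
    using f harmonic_Wirtinger_holomorphic by (auto simp: FH0_def)
  obtain \<epsilon> where \<epsilon>: "cmod \<epsilon> = 1"
    and align: "cmod (dz f z - 1 + \<epsilon> * cnj (dzbar f z)) = cmod (dz f z - 1) + cmod (dzbar f z)"
    using exists_aligning_rotation[of "dz f z - 1" "cnj (dzbar f z)"] by auto
  define F where "F = (\<lambda>z. dz f z - 1 + \<epsilon> * cnj (dzbar f z))"
  have "F holomorphic_on \<DD>"
    unfolding F_def by (intro holomorphic_intros hol)
  moreover have "F 0 = 0" using f by (simp add: F_def FH0_def)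
  moreover have "cmod (F w) < 1" if "cmod w < 1" for w
  proof -
    have "cmod (F w) \<le> cmod (dz f w - 1) + cmod (dzbar f w)"
      unfolding F_def using norm_triangle_ineq[of "dz f w - 1" "\<epsilon> * cnj (dzbar f w)"] \<epsilon>
      by (simp add: norm_mult)
    also have "\<dots> < 1" using f that by (force simp: FH0_def)
    finally show ?thesis .
  qed
  ultimately have "cmod (F z) \<le> cmod z"
    using z by (intro Schwarz_Lemma(1)) auto
  then show ?thesis using align by (simp add: F_def)
qed

lemma FH0_distance_to_id:
  assumes f: "f \<in> FH0" and z: "z \<in> \<DD>"
  shows "cmod (f z - z) \<le> (cmod z)\<^sup>2 / 2"
proof -
  have harm: "harmonic_on \<DD> f" using f by (simp add: FH0_def)
  have tz: "t *\<^sub>R z \<in> \<DD>" if "0 \<le> t" "t \<le> 1" for t :: real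
    using that z mult_left_le_one_le[of "cmod z" t] by simp
  define g where "g = (\<lambda>t. f (t *\<^sub>R z) - t *\<^sub>R z)"
  define g' where "g' = (\<lambda>t. (dz f (t *\<^sub>R z) - 1) * z + dzbar f (t *\<^sub>R z) * cnj z)"
  have g_der: "(g has_vector_derivative g' t) (at t)" if "0 \<le> t" "t \<le> 1" for t
  proof -
    have 1: "((\<lambda>t. t *\<^sub>R z) has_derivative (\<lambda>x. x *\<^sub>R z)) (at t)"
      by (auto intro!: derivative_eq_intros)
    have "((f \<circ> (\<lambda>t. t *\<^sub>R z)) has_derivative
      ((\<lambda>v. dz f (t *\<^sub>R z) * v + dzbar f (t *\<^sub>R z) * cnj v) \<circ> (\<lambda>x. x *\<^sub>R z))) (at t)"
      by (rule diff_chain_at[OF 1 harmonic_on_has_derivative[OF harm tz[OF that]]])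
    from has_derivative_diff[OF this 1] show ?thesis
      unfolding has_vector_derivative_def g_def
      by (auto elim!: has_derivative_eq_rhs simp: fun_eq_iff g'_def algebra_simps)
  qed
  have g'_bound: "cmod (g' t) \<le> t * (cmod z)\<^sup>2" if "0 < t" "t < 1" for t
  proof -
    have "cmod (g' t) \<le> cmod (dz f (t *\<^sub>R z) - 1) * cmod z + cmod (dzbar f (t *\<^sub>R z)) * cmod z"
      unfolding g'_def by (rule order_trans[OF norm_triangle_ineq]) (simp add: norm_mult)
    also have "\<dots> = (cmod (dz f (t *\<^sub>R z) - 1) + cmod (dzbar f (t *\<^sub>R z))) * cmod z"
      by (simp add: algebra_simps)
    also have "\<dots> \<le> cmod (t *\<^sub>R z) * cmod z"
      using that by (intro mult_right_mono FH0_Wirtinger_bound[OF f] tz) auto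
    also have "\<dots> = t * (cmod z)\<^sup>2" using that by (simp add: power2_eq_square)
    finally show ?thesis .
  qed
  have "norm (g 1 - g 0) \<le> 1\<^sup>2 * (cmod z)\<^sup>2 / 2 - 0\<^sup>2 * (cmod z)\<^sup>2 / 2"
  proof (rule differentiable_bound_general
      [of 0 1 g "\<lambda>t. t\<^sup>2 * (cmod z)\<^sup>2 / 2" g' "\<lambda>t. t * (cmod z)\<^sup>2"])
    show "continuous_on {0..1} g"
      using g_der by (intro continuous_at_imp_continuous_on ballI)
        (auto intro: has_vector_derivative_continuous)
    show "((\<lambda>t. t\<^sup>2 * (cmod z)\<^sup>2 / 2) has_vector_derivative t * (cmod z)\<^sup>2) (at t)" for t :: real
      unfolding has_real_derivative_iff_has_vector_derivative[symmetric]
      by (auto intro!: derivative_eq_intros)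
  qed (auto intro!: g_der g'_bound continuous_intros)
  moreover have "f 0 = 0" using f by (simp add: FH0_def)
  ultimately show ?thesis by (simp add: g_def)
qed

lemma FH0_growth:
  assumes "f \<in> FH0" "z \<in> \<DD>"
  shows "cmod z - (cmod z)\<^sup>2 / 2 \<le> cmod (f z)" and "cmod (f z) \<le> cmod z + (cmod z)\<^sup>2 / 2"
  using FH0_distance_to_id[OF assms] norm_triangle_ineq2[of z "f z"] norm_triangle_ineq2[of "f z" z]
  by (auto simp: norm_minus_commute)

lemma FH0_covers:
  assumes f: "f \<in> FH0"
  shows "ball 0 (1/2) \<subseteq> f ` \<DD>"
proof
  fix w :: complex assume "w \<in> ball 0 (1/2)"
  then have w: "cmod w < 1/2" by simp
  \<comment> \<open>The disk of radius \<open>r\<close> is invariant as soon as \<open>\<bar>w\<bar> + r\<^sup>2 / 2 \<le> r\<close>, that is,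
     \<open>(1 - r)\<^sup>2 \<le> 1 - 2 * \<bar>w\<bar>\<close>; since \<open>0 < 1 - 2 * \<bar>w\<bar> \<le> 1\<close>, this number itself can serve
     as \<open>1 - r\<close>.\<close>
  define r where "r = 2 * cmod w"
  have r: "0 \<le> r" "r < 1" using w by (auto simp: r_def)
  have "r * r \<le> r" using r by (simp add: mult_left_le)
  then have inv: "cmod w + r\<^sup>2 / 2 \<le> r" by (simp add: r_def power2_eq_square)
  define T where "T = (\<lambda>z. w - (f z - z))"
  have "continuous_on (cball 0 r) f"
  proof (intro continuous_at_imp_continuous_on ballI)
    fix z :: complex assume "z \<in> cball 0 r"
    with r f show "isCont f z"
      by (intro has_derivative_continuous[OF harmonic_on_has_derivative[of \<DD> f z]])
        (auto simp: FH0_def)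
  qed
  then have "continuous_on (cball 0 r) T"
    unfolding T_def by (intro continuous_intros)
  moreover have "T \<in> cball 0 r \<rightarrow> cball 0 r"
  proof
    fix z :: complex assume "z \<in> cball 0 r"
    then have z: "cmod z \<le> r" "z \<in> \<DD>" using r by auto
    have "cmod (T z) \<le> cmod w + cmod (f z - z)"
      unfolding T_def by (rule norm_triangle_ineq4)
    also have "\<dots> \<le> cmod w + (cmod z)\<^sup>2 / 2" using FH0_distance_to_id[OF f z(2)] by simp
    also have "\<dots> \<le> cmod w + r\<^sup>2 / 2" using z(1) by (simp add: power_mono)
    finally show "T z \<in> cball 0 r" using inv by simp
  qed
  ultimately obtain z where "z \<in> cball 0 r" "T z = z"
    using r(1) brouwer[of "cball 0 r" T] by auto
  then have "f z = w" "z \<in> \<DD>" using r by (auto simp: T_def)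
  then show "w \<in> f ` \<DD>" by blast
qed

section \<open>Extremal functions\<close>

lemma dx_dy_eqI:
  assumes "\<And>z. (f has_derivative f' z) (at z)"
  shows "dx f = (\<lambda>z. f' z 1)" and "dy f = (\<lambda>z. f' z \<i>)"
  using frechet_derivative_at[OF assms] by (auto simp: dx_def dy_def fun_eq_iff)

lemma harmonic_quadratic_in_FH0:
  fixes a b :: complex
  assumes "cmod a + cmod b \<le> 1"
  shows "(\<lambda>z. z + a * z\<^sup>2 / 2 + b * (cnj z)\<^sup>2 / 2) \<in> FH0"
proof -
  let ?f = "\<lambda>z. z + a * z\<^sup>2 / 2 + b * (cnj z)\<^sup>2 / 2"
  have f: "(?f has_derivative (\<lambda>v. v + a * z * v + b * cnj z * cnj v)) (at z)" for z
    by (auto intro!: derivative_eq_intros simp: algebra_simps)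
  have aff: "((\<lambda>z. c + d * z + e * cnj z) has_derivative (\<lambda>v. d * v + e * cnj v)) (at z)"
    for c d e z :: complex
    by (auto intro!: derivative_eq_intros)
  have dxf: "dx ?f = (\<lambda>z. 1 + a * z + b * cnj z)"
    using dx_dy_eqI(1)[OF f] by simp
  have dyf: "dy ?f = (\<lambda>z. \<i> + (\<i> * a) * z + (- \<i> * b) * cnj z)"
    using dx_dy_eqI(2)[OF f] by (simp add: algebra_simps)
  have dxx: "dx (dx ?f) = (\<lambda>z. a + b)" and dyx: "dy (dx ?f) = (\<lambda>z. \<i> * a - \<i> * b)"
    unfolding dxf using dx_dy_eqI[OF aff[of 1 a b]] by (simp_all add: algebra_simps)
  have dxy: "dx (dy ?f) = (\<lambda>z. \<i> * a - \<i> * b)" and dyy: "dy (dy ?f) = (\<lambda>z. - a - b)"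
    unfolding dyf using dx_dy_eqI[OF aff[of \<i> "\<i> * a" "- \<i> * b"]]
    by (simp_all add: algebra_simps)
  have diff: "?f differentiable (at z)" "dx ?f differentiable (at z)" "dy ?f differentiable (at z)" for z
    unfolding dxf dyf using f aff by (blast intro: differentiableI)+
  have cont: "continuous_on \<DD> (dx ?f)" "continuous_on \<DD> (dy ?f)"
    unfolding dxf dyf by (intro continuous_intros)+
  have "C2_on \<DD> ?f"
    unfolding C2_on_def C1_on_def using diff cont by (simp add: dxx dyx dxy dyy)
  then have "harmonic_on \<DD> ?f"
    by (simp add: harmonic_on_def dxx dyy)
  moreover have "dz ?f z = 1 + a * z" and "dzbar ?f z = b * cnj z" for z
    unfolding dz_def dzbar_def dxf dyf by (simp_all add: field_simps)
  moreover have "cmod (a * z) < 1 - cmod (b * cnj z)" if "z \<in> \<DD>" for z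
  proof -
    have "cmod (a * z) + cmod (b * cnj z) = (cmod a + cmod b) * cmod z"
      by (simp add: norm_mult algebra_simps)
    also have "\<dots> \<le> cmod z" using assms by (simp add: mult_left_le_one_le)
    also have "\<dots> < 1" using that by simp
    finally show ?thesis by simp
  qed
  ultimately show ?thesis by (simp add: FH0_def)
qed

text \<open>
  Completing the square, \<open>z + z\<^sup>2 / 2 = ((z + 1)\<^sup>2 - 1) / 2\<close>, so \<open>-1/2\<close> is taken only at the
  critical point \<open>-1\<close> on the unit circle.
\<close>

lemma holomorphic_extremal_omits:
  assumes "cmod z < 1"
  shows "z + z\<^sup>2 / 2 \<noteq> -1/2"
proof
  assume "z + z\<^sup>2 / 2 = -1/2"
  then have "(z + 1)\<^sup>2 = 0" by (simp add: power2_eq_square field_simps)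
  then have "z = -1" by (simp add: add_eq_0_iff2)
  with assms show False by simp
qed

text \<open>
  The imaginary part of \<open>z + (cnj z)\<^sup>2 / 2\<close> is \<open>Im z * (1 - Re z)\<close>, so a real value is taken in the
  disk only on the real axis, where the two extremal functions agree.
\<close>

lemma antiholomorphic_extremal_omits:
  assumes "cmod z < 1"
  shows "z + (cnj z)\<^sup>2 / 2 \<noteq> -1/2"
proof
  assume eq: "z + (cnj z)\<^sup>2 / 2 = -1/2"
  then have "Im (z + (cnj z)\<^sup>2 / 2) = 0" by simp
  then have "Im z * (1 - Re z) = 0" by (simp add: power2_eq_square algebra_simps)
  moreover have "Re z < 1" using assms complex_Re_le_cmod[of z] by linarith
  ultimately have "cnj z = z" by (simp add: complex_eq_iff)
  with eq have "z + z\<^sup>2 / 2 = -1/2" by simp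
  with holomorphic_extremal_omits[OF assms] show False by blast
qed

lemma extremal_sharp:
  fixes f :: "complex \<Rightarrow> complex"
  assumes real: "\<And>x::real. f (of_real x) = of_real (x + x\<^sup>2 / 2)"
    and omits: "\<And>z. cmod z < 1 \<Longrightarrow> f z \<noteq> -1/2"
  shows "(\<forall>r::real. 0 < r \<and> r < 1 \<longrightarrow>
               (\<exists>z. cmod z = r \<and> cmod (f z) = cmod z - (cmod z)\<^sup>2 / 2) \<and>
               (\<exists>z. cmod z = r \<and> cmod (f z) = cmod z + (cmod z)\<^sup>2 / 2)) \<and>
            (\<forall>\<rho>::real. \<rho> > 1/2 \<longrightarrow> \<not> ball 0 \<rho> \<subseteq> f ` \<DD>)"
proof (intro conjI allI impI)
  fix r :: real assume r: "0 < r \<and> r < 1"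
  have "r\<^sup>2 / 2 \<le> r" using r by (simp add: power2_eq_square)
  then have "cmod (f (of_real (- r))) = r - r\<^sup>2 / 2"
    unfolding real norm_of_real by simp
  then show "\<exists>z. cmod z = r \<and> cmod (f z) = cmod z - (cmod z)\<^sup>2 / 2"
    using r by (intro exI[of _ "of_real (- r)"]) (simp del: of_real_minus)
  have "cmod (f (of_real r)) = r + r\<^sup>2 / 2"
    unfolding real norm_of_real using r by simp
  then show "\<exists>z. cmod z = r \<and> cmod (f z) = cmod z + (cmod z)\<^sup>2 / 2"
    using r by (intro exI[of _ "of_real r"]) simp
next
  fix \<rho> :: real assume "\<rho> > 1/2"
  then have "-1/2 \<in> ball (0::complex) \<rho>" by (simp add: norm_divide)
  moreover have "-1/2 \<notin> f ` \<DD>" using omits by force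
  ultimately show "\<not> ball 0 \<rho> \<subseteq> f ` \<DD>" by blast
qed

theorem theorem2p3:
  shows "(\<forall>f\<in>FH0.
            (\<forall>z\<in>\<DD>. cmod z - (cmod z)\<^sup>2 / 2 \<le> cmod (f z) \<and>
                    cmod (f z) \<le> cmod z + (cmod z)\<^sup>2 / 2) \<and>
            ball 0 (1/2) \<subseteq> f ` \<DD>) \<and>
         (\<forall>f\<in>{\<lambda>z. z + z\<^sup>2 / 2, \<lambda>z. z + (cnj z)\<^sup>2 / 2}.
            f \<in> FH0 \<and>
            (\<forall>r::real. 0 < r \<and> r < 1 \<longrightarrow>
               (\<exists>z. cmod z = r \<and> cmod (f z) = cmod z - (cmod z)\<^sup>2 / 2) \<and>
               (\<exists>z. cmod z = r \<and> cmod (f z) = cmod z + (cmod z)\<^sup>2 / 2)) \<and>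
            (\<forall>\<rho>::real. \<rho> > 1/2 \<longrightarrow> \<not> ball 0 \<rho> \<subseteq> f ` \<DD>))"
proof -
  have mem: "(\<lambda>z. z + z\<^sup>2 / 2) \<in> FH0" "(\<lambda>z. z + (cnj z)\<^sup>2 / 2) \<in> FH0"
    using harmonic_quadratic_in_FH0[of 1 0] harmonic_quadratic_in_FH0[of 0 1] by simp_all
  show ?thesis
    using FH0_growth FH0_covers mem
      extremal_sharp[of "\<lambda>z. z + z\<^sup>2 / 2"] extremal_sharp[of "\<lambda>z. z + (cnj z)\<^sup>2 / 2"]
      holomorphic_extremal_omits antiholomorphic_extremal_omits
    by simp
qed

end
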